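(* Assume that each $L_i$ ($1\le i\le d$) is prefix-closed. Let $\mathbb{K}$ be a semiring. A sequence $f\colon\mathbb{N}^d\to\mathbb{K}$ is $(\boldsymbol{\mathcal{S}},\mathbb{K})$-regular if and only if there exist $r\in\mathbb{N}_{\ge1}$ and sequences $f_1,\dots,f_r\colon\mathbb{N}^d\to\mathbb{K}$ such that $f=f_1$ and for all $\boldsymbol{a}\in\boldsymbol{A}$ and all $i\in\{1,\dots,r\}$ there exist $k_{\boldsymbol{a},i,1},\dots,k_{\boldsymbol{a},i,r}\in\mathbb{K}$ with $f_i\circ\boldsymbol{a}=\sum_{j=1}^r k_{\boldsymbol{a},i,j}f_j$.
   Context: An abstract numeration system is a triple $\mathcal{S}=(L,A,<)$ where $L$ is an infinite regular language over a finite alphabet $A$ totally ordered by $<$. Words are ordered by the radix order ($u<_{\rm rad}v$ iff $|u|<|v|$, or $|u|=|v|$ and $u$ is lexicographically smaller); $\mathrm{rep}_{\mathcal{S}}\colon\mathbb{N}\to L$ maps $n$ to the $n$-th word of $L$ (indexing from $0$) and $\mathrm{val}_{\mathcal{S}}$ is its inverse. Fix $d\ge1$, abstract numeration systems $\mathcal{S}_i=(L_i,A_i,<_i)$ for $i\in\{1,\dots,d\}$, $\boldsymbol{\mathcal{S}}=(\mathcal{S}_1,\dots,\mathcal{S}_d)$, and a symbol $\#\notin A_1\cup\dots\cup A_d$. Let $\boldsymbol{\#}=(\#,\dots,\#)$ and $\boldsymbol{A}=\big((A_1\cup\{\#\})\times\cdots\times(A_d\cup\{\#\})\big)\setminus\{\boldsymbol{\#}\}$.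 For words $w_1,\dots,w_d$, $(w_1,\dots,w_d)^\#$ is the word over $\boldsymbol{A}$ obtained by left-padding each $w_i$ with $\#$'s to the maximal length and reading them in parallel. Let $\boldsymbol{L}=\{(w_1,\dots,w_d)^\#: w_i\in L_i\}$, $\mathrm{rep}_{\boldsymbol{\mathcal{S}}}(n_1,\dots,n_d)=(\mathrm{rep}_{\mathcal{S}_1}(n_1),\dots,\mathrm{rep}_{\mathcal{S}_d}(n_d))^\#$ (a bijection $\mathbb{N}^d\to\boldsymbol{L}$), $\mathrm{val}_{\boldsymbol{\mathcal{S}}}$ its inverse. A series $S\colon A^*\to\mathbb{K}$ is $\mathbb{K}$-recognizable if there exist $r\ge1$, a monoid morphism $\mu\colon A^*\to\mathbb{K}^{r\times r}$, $\lambda\in\mathbb{K}^{1\times r}$, $\gamma\in\mathbb{K}^{r\times1}$ with $(S,w)=\lambda\mu(w)\gamma$ for all $w$. A sequence $f\colon\mathbb{N}^d\to\mathbb{K}$ is $(\boldsymbol{\mathcal{S}},\mathbb{K})$-regular if the series $\sum_{\boldsymbol{w}\in\boldsymbol{L}}f(\mathrm{val}_{\boldsymbol{\mathcal{S}}}(\boldsymbol{w}))\,\boldsymbol{w}$ over $\boldsymbol{A}$ is $\mathbb{K}$-recognizable. For $f\colon\mathbb{N}^d\to\mathbb{K}$ and $\boldsymbol{w}\in\boldsymbol{A}^*$, $(f\circ\boldsymbol{w})(\boldsymbol{n})=f(\mathrm{val}_{\boldsymbol{\mathcal{S}}}(\mathrm{rep}_{\boldsymbol{\mathcal{S}}}(\boldsymbol{n})\boldsymbol{w}))$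 if the concatenation $\mathrm{rep}_{\boldsymbol{\mathcal{S}}}(\boldsymbol{n})\boldsymbol{w}$ lies in $\boldsymbol{L}$, and $0$ otherwise.
   Formalization: The coefficients act on the right: f_i∘a is the sum of f_j k_{a,i,j} instead of k_{a,i,j} f_j. For commutative K this is the same; for noncommutative K the claim with left coefficients is false. *)

theory Defs
  imports "Jordan_Normal_Form.Matrix"
begin

definition regular_lang :: "'a set \<Rightarrow> 'a list set \<Rightarrow> bool" where
  "regular_lang A L \<longleftrightarrow>
    (\<exists>(Q :: nat set) q0 F \<delta>.
      finite Q \<and> q0 \<in> Q \<and> F \<subseteq> Q \<and> (\<forall>q\<in>Q. \<forall>a\<in>A. \<delta> q a \<in> Q) \<and>
      L = {w \<in> lists A. foldl \<delta> q0 w \<in> F})"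

definition prefix_closed :: "'a list set \<Rightarrow> bool" where
  "prefix_closed L \<longleftrightarrow> (\<forall>u v. u @ v \<in> L \<longrightarrow> u \<in> L)"

record 'a num_sys =
  lang :: "'a list set"
  alph :: "'a set"
  less_rel :: "'a rel"

definition abstract_num_sys :: "'a num_sys \<Rightarrow> bool" where
  "abstract_num_sys S \<longleftrightarrow>
    finite (alph S) \<and>
    less_rel S \<subseteq> alph S \<times> alph S \<and> strict_linear_order_on (alph S) (less_rel S) \<and>
    infinite (lang S) \<and> regular_lang (alph S) (lang S)"

text \<open>
  The radix order is \<open>lenlex\<close>. The \<open>n\<close>-th word of the language, counting from 0, is the word with
  exactly \<open>n\<close> predecessors in the language; the set of predecessors is finite because the alphabet is.
\<close>

definition rep :: "'a num_sys \<Rightarrow> nat \<Rightarrow> 'a list" where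
  "rep S n = (THE w. w \<in> lang S \<and> card {u \<in> lang S. (u, w) \<in> lenlex (less_rel S)} = n)"

text \<open>
  The finite index type \<open>'d\<close> plays the role of \<open>{1,\<dots>,d}\<close>; the padding symbol is \<open>h\<close>. All alphabets
  \<open>alph (S i)\<close> and \<open>h\<close> live in one letter type \<open>'a\<close>, and the letters of the product alphabet
  are functions \<open>'d \<Rightarrow> 'a\<close>.
\<close>

definition pad_words :: "'a \<Rightarrow> ('d::finite \<Rightarrow> 'a list) \<Rightarrow> ('d \<Rightarrow> 'a) list" where
  "pad_words h w =
    (let m = Max (range (\<lambda>i. length (w i)))
     in map (\<lambda>p i. (replicate (m - length (w i)) h @ w i) ! p) [0..<m])"

definition prod_alph :: "'a \<Rightarrow> ('d::finite \<Rightarrow> 'a num_sys) \<Rightarrow> ('d \<Rightarrow> 'a) set" where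
  "prod_alph h S = {a. \<forall>i. a i \<in> alph (S i) \<union> {h}} - {\<lambda>i. h}"

definition prod_lang :: "'a \<Rightarrow> ('d::finite \<Rightarrow> 'a num_sys) \<Rightarrow> ('d \<Rightarrow> 'a) list set" where
  "prod_lang h S = {pad_words h w | w. \<forall>i. w i \<in> lang (S i)}"

definition prod_rep ::
    "'a \<Rightarrow> ('d::finite \<Rightarrow> 'a num_sys) \<Rightarrow> ('d \<Rightarrow> nat) \<Rightarrow> ('d \<Rightarrow> 'a) list" where
  "prod_rep h S n = pad_words h (\<lambda>i. rep (S i) (n i))"

definition prod_val ::
    "'a \<Rightarrow> ('d::finite \<Rightarrow> 'a num_sys) \<Rightarrow> ('d \<Rightarrow> 'a) list \<Rightarrow> ('d \<Rightarrow> nat)" where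
  "prod_val h S = inv_into UNIV (prod_rep h S)"

text \<open>
  A semiring is a type of sort \<open>{semiring_0, monoid_mult}\<close>: multiplication need not commute and,
  unlike in \<open>semiring_1\<close>, the one-element semiring is allowed. Only the values of a series over the
  alphabet \<open>A\<close> on \<open>lists A\<close> are relevant.
\<close>

definition recognizable ::
    "'b set \<Rightarrow> ('b list \<Rightarrow> 'k::{semiring_0,monoid_mult}) \<Rightarrow> bool" where
  "recognizable A s \<longleftrightarrow>
    (\<exists>r \<ge> 1. \<exists>(\<mu> :: 'b list \<Rightarrow> 'k mat) (l :: 'k mat) (g :: 'k mat).
      (\<forall>w \<in> lists A. \<mu> w \<in> carrier_mat r r) \<and>
      \<mu> [] = 1\<^sub>m r \<and> (\<forall>u \<in> lists A. \<forall>v \<in> lists A. \<mu> (u @ v) = \<mu> u * \<mu> v) \<and>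
      l \<in> carrier_mat 1 r \<and> g \<in> carrier_mat r 1 \<and>
      (\<forall>w \<in> lists A. s w = (l * \<mu> w * g) $$ (0, 0)))"

definition regular_seq ::
    "'a \<Rightarrow> ('d::finite \<Rightarrow> 'a num_sys) \<Rightarrow> (('d \<Rightarrow> nat) \<Rightarrow> 'k::{semiring_0,monoid_mult}) \<Rightarrow> bool" where
  "regular_seq h S f \<longleftrightarrow>
    recognizable (prod_alph h S) (\<lambda>w. if w \<in> prod_lang h S then f (prod_val h S w) else 0)"

definition seq_comp ::
    "'a \<Rightarrow> ('d::finite \<Rightarrow> 'a num_sys) \<Rightarrow> (('d \<Rightarrow> nat) \<Rightarrow> 'k::zero) \<Rightarrow> ('d \<Rightarrow> 'a) list
      \<Rightarrow> ('d \<Rightarrow> nat) \<Rightarrow> 'k" where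
  "seq_comp h S f w n =
    (if prod_rep h S n @ w \<in> prod_lang h S then f (prod_val h S (prod_rep h S n @ w)) else 0)"

text \<open>
  The linear combination of the sequences \<open>fs 1, \<dots>, fs r\<close> with coefficients \<open>k 1, \<dots>, k r\<close>.
  Sequences form a right module over the semiring: coefficients act on the right. For a commutative
  semiring the side is immaterial. In general it is dictated by writing a recognizable series as
  \<open>l * \<mu> w * g\<close>: appending a letter \<open>a\<close> to \<open>w\<close> multiplies \<open>l * \<mu> w\<close> by \<open>\<mu> [a]\<close> on the right.
\<close>

definition lin_comb ::
    "nat \<Rightarrow> (nat \<Rightarrow> 'k::semiring_0) \<Rightarrow> (nat \<Rightarrow> ('d \<Rightarrow> nat) \<Rightarrow> 'k) \<Rightarrow> ('d \<Rightarrow> nat) \<Rightarrow> 'k" where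
  "lin_comb r k fs n = (\<Sum>j = 1..r. fs j n * k j)"

end

(* Let L be the language of padded tuples and v(w) the row vector l * mu(w).

   If f is regular, then w |-> v(w) is updated by a matrix product when a letter is appended, but
   f o a vanishes where rep(n)a leaves L. Since L has finitely many left quotients, the entries of v
   restricted to the words with a given left quotient of L are still finitely many sequences; as the
   quotient by u decides whether ua is in L and determines the quotient by ua, they span a family
   stable under all f |-> f o a, and f can be added to it.

   Conversely, the matrices of coefficients, the row of initial values and the first unit vector
   represent f: outside of L the row vector is 0 and stays 0 because L is prefix-closed. *)

theory Submission
  imports Defs
begin

section \<open>Left quotients and padded words\<close>

text \<open>Left quotients are the states of the minimal automaton of \<open>L\<close>; with them no
  product automaton has to be built for padded tuples.\<close>

definition lquot :: "'a list set \<Rightarrow> 'a list \<Rightarrow> 'a list set" where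
  "lquot L u = {v. u @ v \<in> L}"

text \<open>The amount of padding is left open, because in a tuple it depends on the lengths of the
  other components.\<close>

definition padded :: "'a \<Rightarrow> 'a list set \<Rightarrow> 'a list set" where
  "padded h L = {replicate k h @ v | k v. v \<in> L}"

lemma lquot_snoc: "lquot L (u @ [a]) = {v. a # v \<in> lquot L u}"
  by (simp add: lquot_def)

lemma regular_lang_subset_lists: "regular_lang A L \<Longrightarrow> L \<subseteq> lists A"
  by (auto simp: regular_lang_def)

text \<open>After a word over \<open>A\<close> the quotient depends only on the state reached; every
  other word has the empty quotient.\<close>

lemma finite_lquot_regular_lang:
  assumes "regular_lang A L"
  shows "finite (range (lquot L))"
proof -
  from assms obtain Q :: "nat set" and q0 F \<delta> where "finite Q \<and> q0 \<in> Q \<and> F \<subseteq> Q \<and>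
      (\<forall>q\<in>Q. \<forall>a\<in>A. \<delta> q a \<in> Q) \<and> L = {w \<in> lists A. foldl \<delta> q0 w \<in> F}"
    unfolding regular_lang_def by (elim exE)
  then have Q: "finite Q" "q0 \<in> Q" "\<forall>q\<in>Q. \<forall>a\<in>A. \<delta> q a \<in> Q"
    and L: "L = {w \<in> lists A. foldl \<delta> q0 w \<in> F}"
    by simp_all
  have *: "foldl \<delta> q u \<in> Q" if "u \<in> lists A" "q \<in> Q" for q u
    using that Q(3) by (induction u arbitrary: q) auto
  have "lquot L u \<in> insert {} ((\<lambda>q. {v \<in> lists A. foldl \<delta> q v \<in> F}) ` Q)" for u
  proof (cases "u \<in> lists A")
    case True
    then have "lquot L u = {v \<in> lists A. foldl \<delta> (foldl \<delta> q0 u) v \<in> F}"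
      by (auto simp: lquot_def L)
    then show ?thesis
      using *[OF True Q(2)] by blast
  next
    case False
    then show ?thesis
      by (auto simp: lquot_def L)
  qed
  then show ?thesis
    by (intro finite_subset[OF image_subsetI finite.insertI[OF finite_imageI[OF Q(1)]]])
qed

lemma Nil_in_padded_iff: "[] \<in> padded h L \<longleftrightarrow> [] \<in> L"
  by (auto simp: padded_def)

lemma padded_superset: "L \<subseteq> padded h L"
  unfolding padded_def by (force intro: exI[of _ 0])

text \<open>As \<open>h\<close> occurs in no word of \<open>L\<close>, a leading \<open>h\<close>
  must be padding, and any other first letter ends the padding. This allows recursion along the
  word.\<close>

lemma Cons_in_padded_iff:
  assumes "L \<subseteq> lists A" "h \<notin> A"
  shows "a # w \<in> padded h L \<longleftrightarrow> (if a = h then w \<in> padded h L else a # w \<in> L)"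
proof (cases "a = h")
  case True
  have "w \<in> padded h L" if "h # w = replicate k h @ v" "v \<in> L" for k v
    using that assms by (cases k) (auto simp: padded_def)
  moreover have "h # w \<in> padded h L" if "w = replicate k h @ v" "v \<in> L" for k v
  proof -
    have "h # w = replicate (Suc k) h @ v"
      using that by simp
    then show ?thesis
      using that(2) unfolding padded_def by blast
  qed
  ultimately show ?thesis
    using True by (auto simp: padded_def)
next
  case False
  have "a # w \<in> L" if "a # w = replicate k h @ v" "v \<in> L" for k v
    using that False by (cases k) auto
  then show ?thesis
    using False padded_superset[of L h] by (auto simp: padded_def)
qed

text \<open>Leading copies of \<open>h\<close> in \<open>u\<close> do not change the quotient. If
  nothing else is left, it is \<open>padded h L\<close> itself, otherwise a quotient of
  \<open>L\<close>: padding adds at most one state.\<close>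

lemma finite_lquot_padded:
  assumes "L \<subseteq> lists A" "h \<notin> A" "finite (range (lquot L))"
  shows "finite (range (lquot (padded h L)))"
proof -
  have "lquot (padded h L) u \<in> insert (padded h L) (range (lquot L))" for u
  proof (induction u)
    case Nil
    then show ?case
      by (simp add: lquot_def)
  next
    case (Cons a u)
    show ?case
    proof (cases "a = h")
      case True
      then have "lquot (padded h L) (a # u) = lquot (padded h L) u"
        by (simp add: lquot_def Cons_in_padded_iff[OF assms(1,2)])
      then show ?thesis
        using Cons by simp
    next
      case False
      then have "lquot (padded h L) (a # u) = lquot L (a # u)"
        by (simp add: lquot_def Cons_in_padded_iff[OF assms(1,2)])
      then show ?thesis
        by simp
    qed
  qed
  then show ?thesis
    by (meson assms(3) finite.insertI finite_subset image_subsetI)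
qed

text \<open>A prefix may consist of padding alone; this is where \<open>[] \<in> L\<close>
  enters.\<close>

lemma prefix_closed_padded:
  assumes "L \<subseteq> lists A" "h \<notin> A" "prefix_closed L" "[] \<in> L"
  shows "prefix_closed (padded h L)"
proof -
  have "u @ v \<in> padded h L \<Longrightarrow> u \<in> padded h L" for u v
  proof (induction u)
    case Nil
    then show ?case
      using assms(4) by (simp add: Nil_in_padded_iff)
  next
    case (Cons a u)
    have "a # u \<in> L" if "a # u @ v \<in> L"
      using assms(3) that append_Cons[of a u v] unfolding prefix_closed_def by metis
    then show ?case
      using Cons by (auto simp: Cons_in_padded_iff[OF assms(1,2)] split: if_splits)
  qed
  then show ?thesis
    unfolding prefix_closed_def by blast
qed

section \<open>The product language\<close>

lemma length_pad_words: "length (pad_words h w) = Max (range (\<lambda>i. length (w i)))"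
  by (simp add: pad_words_def Let_def)

text \<open>Together with \<open>components_eqI\<close> this replaces positions in padded tuples by
  reasoning in one component at a time.\<close>

lemma map_pad_words:
  fixes w :: "'d::finite \<Rightarrow> 'a list"
  shows "map (\<lambda>a. a i) (pad_words h w)
    = replicate (Max (range (\<lambda>i. length (w i))) - length (w i)) h @ w i"
proof -
  have "length (w i) \<le> Max (range (\<lambda>i. length (w i)))"
    by simp
  then show ?thesis
    by (intro nth_equalityI) (auto simp: pad_words_def Let_def)
qed

lemma components_eqI:
  assumes "length u = length v" "\<And>i. map (\<lambda>a. a i) u = map (\<lambda>a. a i) v"
  shows "u = v"
proof (rule nth_equalityI)
  fix p assume p: "p < length u"
  show "u ! p = v ! p"
  proof
    fix i
    show "(u ! p) i = (v ! p) i"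
      using arg_cong[OF assms(2)[of i], of "\<lambda>w. w ! p"] p assms(1) by simp
  qed
qed (fact assms(1))

text \<open>Dropping the leading copies of \<open>h\<close> from component \<open>i\<close> recovers
  \<open>w i\<close>.\<close>

lemma pad_words_inj:
  fixes w w' :: "'d::finite \<Rightarrow> 'a list"
  assumes "pad_words h w = pad_words h w'" "\<And>i. h \<notin> set (w i)" "\<And>i. h \<notin> set (w' i)"
  shows "w = w'"
proof
  fix i
  have dropWhile_pad: "dropWhile ((=) h) (replicate k h @ v) = v" if "h \<notin> set v" for k v
  proof (induction k)
    case 0
    then show ?case
      using that by (cases v) auto
  qed simp
  have "dropWhile ((=) h) (map (\<lambda>a. a i) (pad_words h w))
      = dropWhile ((=) h) (map (\<lambda>a. a i) (pad_words h w'))"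
    using assms(1) by simp
  then show "w i = w' i"
    unfolding map_pad_words using dropWhile_pad assms(2,3) by metis
qed

text \<open>Membership is tested in each component separately. Excluding the letter with all
  components \<open>h\<close> makes this exact: some component then starts without padding, so the
  common length is the maximal one.\<close>

lemma prod_lang_eq:
  fixes S :: "'d::finite \<Rightarrow> 'a num_sys"
  assumes L: "\<And>i. lang (S i) \<subseteq> lists (alph (S i))" and h: "\<And>i. h \<notin> alph (S i)"
  shows "prod_lang h S
    = {u \<in> lists (prod_alph h S). \<forall>i. map (\<lambda>a. a i) u \<in> padded h (lang (S i))}"
proof (intro equalityI subsetI)
  fix u assume "u \<in> prod_lang h S"
  then obtain w where u: "u = pad_words h w" and w: "\<And>i. w i \<in> lang (S i)"
    by (auto simp: prod_lang_def)
  let ?m = "Max (range (\<lambda>i. length (w i)))"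
  have wa: "set (w i) \<subseteq> alph (S i)" for i
    using w L by blast
  have "a \<in> prod_alph h S" if "a \<in> set u" for a
  proof -
    have "a i \<in> alph (S i) \<union> {h}" for i
    proof -
      have "a i \<in> set (map (\<lambda>a. a i) u)"
        using that by simp
      then show ?thesis
        unfolding u map_pad_words using wa[of i] by (auto split: if_splits)
    qed
    \<comment> \<open>A component of maximal length gets no padding, so no letter of
      \<open>u\<close> is \<open>h\<close> there.\<close>
    moreover have "a \<noteq> (\<lambda>i. h)"
    proof -
      have "?m \<in> range (\<lambda>i. length (w i))"
        by (intro Max_in) auto
      then obtain i where i: "?m = length (w i)"
        by blast
      have "a i \<in> set (map (\<lambda>a. a i) u)"
        using that by simp
      then have "a i \<in> set (w i)"
        unfolding u map_pad_words using i by simp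
      then show ?thesis
        using wa[of i] h[of i] by auto
    qed
    ultimately show ?thesis
      by (auto simp: prod_alph_def)
  qed
  moreover have "map (\<lambda>a. a i) u \<in> padded h (lang (S i))" for i
    unfolding u map_pad_words padded_def using w by blast
  ultimately show "u \<in> {u \<in> lists (prod_alph h S). \<forall>i. map (\<lambda>a. a i) u \<in> padded h (lang (S i))}"
    by auto
next
  fix u assume "u \<in> {u \<in> lists (prod_alph h S). \<forall>i. map (\<lambda>a. a i) u \<in> padded h (lang (S i))}"
  then have uA: "u \<in> lists (prod_alph h S)"
    and "\<forall>i. \<exists>k v. map (\<lambda>a. a i) u = replicate k h @ v \<and> v \<in> lang (S i)"
    by (auto simp: padded_def)
  then obtain k w where kw: "\<And>i. map (\<lambda>a. a i) u = replicate (k i) h @ w i"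
    and w: "\<And>i. w i \<in> lang (S i)"
    by metis
  have len: "length u = k i + length (w i)" for i
    using arg_cong[OF kw, of length i] by simp
  \<comment> \<open>The numbers \<open>k i\<close> are the right amounts of padding as soon as one
    of them is 0. This holds in a component where the first letter of \<open>u\<close> differs from
    \<open>h\<close>.\<close>
  have "length u \<in> range (\<lambda>i. length (w i))"
  proof (cases u)
    case Nil
    then show ?thesis
      using len by auto
  next
    case (Cons a u')
    then obtain i where "a i \<noteq> h"
      using uA by (force simp: prod_alph_def)
    then have "k i = 0"
      using kw[of i] Cons by (cases "k i") auto
    then show ?thesis
      using len[of i] by (intro range_eqI[of _ _ i]) simp
  qed
  moreover have "length (w i) \<le> length u" for i
    using len[of i] by simp
  ultimately have m: "Max (range (\<lambda>i. length (w i))) = length u"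
    by (intro Max_eqI) auto
  have "pad_words h w = u"
  proof (rule components_eqI)
    show "length (pad_words h w) = length u"
      by (simp add: length_pad_words m)
    show "map (\<lambda>a. a i) (pad_words h w) = map (\<lambda>a. a i) u" for i
      unfolding map_pad_words m kw using len[of i] by simp
  qed
  then show "u \<in> prod_lang h S"
    using w by (auto simp: prod_lang_def)
qed

text \<open>By \<open>prod_lang_eq\<close>, the quotient by a word over the product alphabet is
  determined, through \<open>G\<close>, by the tuple of the quotients in the components, and there
  are finitely many such tuples.\<close>

lemma finite_lquot_prod_lang:
  fixes S :: "'d::finite \<Rightarrow> 'a num_sys"
  assumes "\<And>i. regular_lang (alph (S i)) (lang (S i))" and h: "\<And>i. h \<notin> alph (S i)"
  shows "finite (range (lquot (prod_lang h S)))"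
proof -
  note L = regular_lang_subset_lists[OF assms(1)]
  let ?R = "\<lambda>i. range (lquot (padded h (lang (S i))))"
  define G where "G = (\<lambda>Q. {v \<in> lists (prod_alph h S). \<forall>i. map (\<lambda>a. a i) v \<in> Q i})"
  have "finite (PiE UNIV ?R)"
    by (intro finite_PiE finite_lquot_padded[OF L h finite_lquot_regular_lang[OF assms(1)]]) simp
  then have fin: "finite (insert {} (G ` PiE UNIV ?R))"
    by simp
  have "lquot (prod_lang h S) u \<in> insert {} (G ` PiE UNIV ?R)" for u
  proof (cases "u \<in> lists (prod_alph h S)")
    case True
    let ?Q = "\<lambda>i. lquot (padded h (lang (S i))) (map (\<lambda>a. a i) u)"
    have "lquot (prod_lang h S) u = G ?Q"
      using True unfolding lquot_def G_def prod_lang_eq[OF L h] by simp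
    moreover have "G ?Q \<in> G ` PiE UNIV ?R"
      unfolding PiE_UNIV_domain by (rule imageI, rule Pi_I, rule rangeI)
    ultimately show ?thesis
      by (simp only: insertI2)
  next
    case False
    then show ?thesis
      unfolding lquot_def prod_lang_eq[OF L h] by simp
  qed
  then show ?thesis
    by (intro finite_subset[OF image_subsetI fin])
qed

lemma prefix_closed_prod_lang:
  fixes S :: "'d::finite \<Rightarrow> 'a num_sys"
  assumes L: "\<And>i. lang (S i) \<subseteq> lists (alph (S i))" and h: "\<And>i. h \<notin> alph (S i)"
    and p: "\<And>i. prefix_closed (lang (S i))" and e: "\<And>i. [] \<in> lang (S i)"
  shows "prefix_closed (prod_lang h S)"
  unfolding prefix_closed_def
proof (intro allI impI)
  fix u v assume uv: "u @ v \<in> prod_lang h S"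
  have "map (\<lambda>a. a i) u \<in> padded h (lang (S i))" for i
  proof -
    have "map (\<lambda>a. a i) u @ map (\<lambda>a. a i) v \<in> padded h (lang (S i))"
      using uv by (simp add: prod_lang_eq[OF L h])
    then show ?thesis
      using prefix_closed_padded[OF L h p e] unfolding prefix_closed_def by blast
  qed
  then show "u \<in> prod_lang h S"
    using uv by (simp add: prod_lang_eq[OF L h])
qed

section \<open>The numeration bijections\<close>

text \<open>The order on letters is total only on the alphabet, so totality of the radix order is
  stated relative to words over it.\<close>

lemma lenlex_total_on_lists:
  assumes "total_on A r" "u \<in> lists A" "v \<in> lists A" "u \<noteq> v"
  shows "(u, v) \<in> lenlex r \<or> (v, u) \<in> lenlex r"
  using assms(2-4)
proof (induction u arbitrary: v)
  case Nil
  then show ?case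
    by auto
next
  case (Cons a u)
  show ?case
  proof (cases v)
    case Nil
    then show ?thesis
      by auto
  next
    case v: (Cons b v')
    then have "u = v' \<or> (u, v') \<in> lenlex r \<or> (v', u) \<in> lenlex r"
      using Cons by auto
    moreover have "a = b \<or> (a, b) \<in> r \<or> (b, a) \<in> r"
      using Cons.hyps Cons.prems assms(1) v by (auto simp: total_on_def)
    ultimately show ?thesis
      using Cons.prems linorder_less_linear[of "length u" "length v'"]
      unfolding v Cons_lenlex_iff by auto
  qed
qed

text \<open>The number \<open>c w\<close> of predecessors is finite and strictly increasing in the
  radix order, hence \<open>c\<close> is injective on the language. Its range is infinite and closed
  downwards, so \<open>c\<close> is a bijection onto the naturals, and \<open>rep S\<close> is its
  inverse.\<close>

lemma bij_betw_rep:
  assumes "abstract_num_sys S"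
  shows "bij_betw (rep S) UNIV (lang S)"
proof -
  define r where "r = lenlex (less_rel S)"
  define c where "c = (\<lambda>w. card {u \<in> lang S. (u, w) \<in> r})"
  have fin: "finite (alph S)" and slo: "strict_linear_order_on (alph S) (less_rel S)"
    and inf: "infinite (lang S)" and L: "lang S \<subseteq> lists (alph S)"
    using assms regular_lang_subset_lists by (auto simp: abstract_num_sys_def)
  have trans: "trans r" and irrefl: "(w, w) \<notin> r" for w
    using slo lenlex_irreflexive[of "less_rel S"]
    by (auto simp: r_def strict_linear_order_on_def irrefl_def)
  have total: "(u, v) \<in> r \<or> (v, u) \<in> r" if "u \<in> lang S" "v \<in> lang S" "u \<noteq> v" for u v
    using slo L that unfolding r_def strict_linear_order_on_def
    by (intro lenlex_total_on_lists[of "alph S"]) auto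
  have finp: "finite {u \<in> lang S. (u, w) \<in> r}" for w
  proof (rule finite_subset)
    show "{u \<in> lang S. (u, w) \<in> r} \<subseteq> {u. set u \<subseteq> alph S \<and> length u \<le> length w}"
      using L by (auto simp: r_def dest: lenlex_length)
    show "finite {u. set u \<subseteq> alph S \<and> length u \<le> length w}"
      using fin by (rule finite_lists_length_le)
  qed
  have mono: "c u < c v" if "u \<in> lang S" "(u, v) \<in> r" for u v
    unfolding c_def
  proof (rule psubset_card_mono[OF finp])
    have "{x \<in> lang S. (x, u) \<in> r} \<subseteq> {x \<in> lang S. (x, v) \<in> r}"
      using that trans by (auto elim: transE)
    then show "{x \<in> lang S. (x, u) \<in> r} \<subset> {x \<in> lang S. (x, v) \<in> r}"
      using that irrefl[of u] by blast
  qed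
  have inj: "inj_on c (lang S)"
  proof (rule inj_onI, rule ccontr)
    fix u v assume "u \<in> lang S" "v \<in> lang S" "c u = c v" "u \<noteq> v"
    then show False
      using total[of u v] mono[of u v] mono[of v u] by auto
  qed
  have surj: "n \<in> c ` lang S" for n
  proof -
    have "infinite (c ` lang S)"
      using inf inj finite_imageD by blast
    then have "\<not> c ` lang S \<subseteq> {..n}"
      using finite_subset by blast
    then obtain w where w: "w \<in> lang S" "n < c w"
      using not_le by blast
    let ?P = "{u \<in> lang S. (u, w) \<in> r}"
    (* c maps the c w predecessors of w injectively into {..<c w}, hence onto. *)
    have "c ` ?P \<subseteq> {..<c w}"
      using mono by auto
    moreover have "card (c ` ?P) = card {..<c w}"
      using card_image[OF inj_on_subset[OF inj, of ?P]] by (auto simp: c_def)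
    ultimately have "c ` ?P = {..<c w}"
      by (intro card_subset_eq) auto
    then show ?thesis
      using w(2) by blast
  qed
  have bij: "bij_betw c (lang S) UNIV"
    using inj surj by (auto simp: bij_betw_def)
  \<comment> \<open>Once unfolded, both sides are the same definite description.\<close>
  have rep_eq: "rep S n = the_inv_into (lang S) c n" for n
    unfolding rep_def the_inv_into_def c_def r_def ..
  then have "rep S = the_inv_into (lang S) c"
    by blast
  then show ?thesis
    using bij_betw_the_inv_into[OF bij] by simp
qed

lemma bij_betw_prod_rep:
  fixes S :: "'d::finite \<Rightarrow> 'a num_sys"
  assumes S: "\<And>i. abstract_num_sys (S i)" and h: "\<And>i. h \<notin> alph (S i)"
  shows "bij_betw (prod_rep h S) UNIV (prod_lang h S)"
proof (rule bij_betwI')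
  note rep_bij = bij_betw_rep[OF S]
  have rep_in: "rep (S i) k \<in> lang (S i)" for i k
    using rep_bij[of i] by (auto simp: bij_betw_def)
  have "lang (S i) \<subseteq> lists (alph (S i))" for i
    using S[of i] regular_lang_subset_lists unfolding abstract_num_sys_def by metis
  then have no_h: "h \<notin> set (rep (S i) k)" for i k
    using rep_in[of i k] h[of i] by blast
  show "prod_rep h S m = prod_rep h S n \<longleftrightarrow> m = n" for m n
  proof
    assume "prod_rep h S m = prod_rep h S n"
    then have "(\<lambda>i. rep (S i) (m i)) = (\<lambda>i. rep (S i) (n i))"
      unfolding prod_rep_def by (rule pad_words_inj) (simp_all add: no_h)
    then have "rep (S i) (m i) = rep (S i) (n i)" for i
      by meson
    then show "m = n"
      using rep_bij by (intro ext injD[of "rep (S _)"]) (auto simp: bij_betw_def)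
  qed simp
  show "prod_rep h S n \<in> prod_lang h S" for n
    using rep_in by (auto simp: prod_rep_def prod_lang_def)
  show "\<exists>n\<in>UNIV. w = prod_rep h S n" if w: "w \<in> prod_lang h S" for w
  proof -
    obtain u where u: "w = pad_words h u" "\<And>i. u i \<in> lang (S i)"
      using w by (auto simp: prod_lang_def)
    then have "\<forall>i. \<exists>k. u i = rep (S i) k"
      using rep_bij unfolding bij_betw_def by (metis imageE)
    then obtain n where "\<And>i. u i = rep (S i) (n i)"
      by metis
    then have "u = (\<lambda>i. rep (S i) (n i))"
      by blast
    then show ?thesis
      using u(1) by (intro bexI[of _ n]) (simp_all add: prod_rep_def)
  qed
qed

section \<open>Recognizable series and stable families\<close>

text \<open>
  The versions in the library require \<open>semiring_1\<close>, which excludes the one-element semiring.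
\<close>

lemma left_mult_one_mat_weak:
  "(M :: 'k::{semiring_0,monoid_mult} mat) \<in> carrier_mat m n \<Longrightarrow> 1\<^sub>m m * M = M"
  by (intro eq_matI) (auto simp: scalar_prod_def if_distrib[of "\<lambda>x. x * _"] cong: if_cong)

lemma right_mult_one_mat_weak:
  "(M :: 'k::{semiring_0,monoid_mult} mat) \<in> carrier_mat m n \<Longrightarrow> M * 1\<^sub>m n = M"
  by (intro eq_matI) (auto simp: scalar_prod_def if_distrib[of "\<lambda>x. _ * x"] cong: if_cong)

lemma mult_mat_entry:
  assumes "M \<in> carrier_mat m r" "N \<in> carrier_mat r n" "i < m" "j < n"
  shows "(M * N) $$ (i, j) = (\<Sum>l<r. M $$ (i, l) * N $$ (l, j))"
  using assms by (auto simp: scalar_prod_def atLeast0LessThan intro!: sum.cong)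

text \<open>It suffices to give a row vector for each word that is multiplied by \<open>M a\<close>
  when \<open>a\<close> is appended. The morphism is the product of the matrices of the letters, and
  \<open>rowv w\<close> is then \<open>l * \<mu> w\<close>.\<close>

lemma recognizableI:
  fixes s :: "'b list \<Rightarrow> 'k::{semiring_0,monoid_mult}"
  assumes r: "r \<ge> 1" and M: "\<And>a. M a \<in> carrier_mat r r"
    and l: "l \<in> carrier_mat 1 r" and g: "g \<in> carrier_mat r 1"
    and row_Nil: "rowv [] = l" and row_snoc: "\<And>u a. u \<in> lists A \<Longrightarrow> a \<in> A \<Longrightarrow> rowv (u @ [a]) = rowv u * M a"
    and s: "\<And>w. w \<in> lists A \<Longrightarrow> s w = (rowv w * g) $$ (0, 0)"
  shows "recognizable A s"
proof -
  define \<mu> where "\<mu> = (\<lambda>w. foldr (\<lambda>a N. M a * N) w (1\<^sub>m r))"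
  have \<mu>_simps: "\<mu> [] = 1\<^sub>m r" "\<mu> (a # w) = M a * \<mu> w" for a w
    by (simp_all add: \<mu>_def)
  have \<mu>: "\<mu> w \<in> carrier_mat r r" for w
    by (induction w) (auto simp: \<mu>_simps intro!: mult_carrier_mat[OF M])
  have \<mu>_append: "\<mu> (u @ v) = \<mu> u * \<mu> v" for u v
    by (induction u) (simp_all add: \<mu>_simps left_mult_one_mat_weak[OF \<mu>] assoc_mult_mat[OF M \<mu> \<mu>])
  have \<mu>_single: "\<mu> [a] = M a" for a
    by (simp add: \<mu>_simps right_mult_one_mat_weak[OF M])
  have rowv: "rowv w = l * \<mu> w" if "w \<in> lists A" for w
    using that
  proof (induction w rule: rev_induct)
    case Nil
    then show ?case
      by (simp add: row_Nil \<mu>_simps right_mult_one_mat_weak[OF l])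
  next
    case (snoc a u)
    then have "rowv (u @ [a]) = l * \<mu> u * M a"
      by (simp add: row_snoc)
    then show ?case
      by (simp add: \<mu>_append \<mu>_single assoc_mult_mat[OF l \<mu> M])
  qed
  show ?thesis
    unfolding recognizable_def
    using r l g by (intro exI[of _ r] conjI exI[where x = \<mu>] exI[where x = l] exI[where x = g])
      (simp_all add: \<mu> \<mu>_simps(1) \<mu>_append s rowv)
qed

text \<open>Here \<open>v w\<close> holds the entries of \<open>l * \<mu> w\<close>, and
  \<open>m a\<close> those of \<open>\<mu> [a]\<close>. Entries instead of matrices are used because
  they are to become sequences.\<close>

lemma recognizableE:
  fixes s :: "'b list \<Rightarrow> 'k::{semiring_0,monoid_mult}"
  assumes "recognizable A s"
  obtains r :: nat and v :: "'b list \<Rightarrow> nat \<Rightarrow> 'k" and m :: "'b \<Rightarrow> nat \<Rightarrow> nat \<Rightarrow> 'k" and g :: "nat \<Rightarrow> 'k"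
  where "\<And>u a j. u \<in> lists A \<Longrightarrow> a \<in> A \<Longrightarrow> j < r \<Longrightarrow> v (u @ [a]) j = (\<Sum>i<r. v u i * m a i j)"
    and "\<And>w. w \<in> lists A \<Longrightarrow> s w = (\<Sum>j<r. v w j * g j)"
proof -
  obtain r \<mu> l g where \<mu>: "\<And>w. w \<in> lists A \<Longrightarrow> \<mu> w \<in> carrier_mat r r"
    and \<mu>_append: "\<And>u v. u \<in> lists A \<Longrightarrow> v \<in> lists A \<Longrightarrow> \<mu> (u @ v) = \<mu> u * \<mu> v"
    and l: "l \<in> carrier_mat 1 r" and g: "g \<in> carrier_mat r 1"
    and s: "\<And>w. w \<in> lists A \<Longrightarrow> s w = (l * \<mu> w * g) $$ (0, 0)"
    using assms unfolding recognizable_def by metis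
  have lm: "l * \<mu> w \<in> carrier_mat 1 r" if "w \<in> lists A" for w
    using l \<mu>[OF that] by simp
  show thesis
  proof (rule that)
    fix u a j assume u: "u \<in> lists A" and a: "a \<in> A" and j: "j < r"
    have a': "[a] \<in> lists A"
      using a by simp
    have "l * \<mu> (u @ [a]) = l * \<mu> u * \<mu> [a]"
      using assoc_mult_mat[OF l \<mu>[OF u] \<mu>[OF a']] \<mu>_append[OF u a'] by simp
    then show "(l * \<mu> (u @ [a])) $$ (0, j) = (\<Sum>i<r. (l * \<mu> u) $$ (0, i) * \<mu> [a] $$ (i, j))"
      using mult_mat_entry[OF lm[OF u] \<mu>[OF a'], of 0 j] j by simp
  next
    fix w assume w: "w \<in> lists A"
    show "s w = (\<Sum>j<r. (l * \<mu> w) $$ (0, j) * g $$ (j, 0))"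
      using s[OF w] mult_mat_entry[OF lm[OF w] g, of 0 0] by simp
  qed
qed

text \<open>Stable families arise with other index sets than \<open>{1..r}\<close>. The enumeration
  \<open>b\<close> reserves 1 for \<open>z\<close>, since the given sequence has to come
  first.\<close>

lemma stable_family_reindex:
  fixes F :: "'x \<Rightarrow> ('d::finite \<Rightarrow> nat) \<Rightarrow> 'k::{semiring_0,monoid_mult}"
  assumes I: "finite I" "z \<in> I" and f: "f = F z"
    and stable: "\<And>a x. a \<in> A \<Longrightarrow> x \<in> I \<Longrightarrow>
      \<exists>k. \<forall>n. seq_comp h S (F x) [a] n = (\<Sum>y\<in>I. F y n * k y)"
  shows "\<exists>r \<ge> 1. \<exists>fs :: nat \<Rightarrow> ('d \<Rightarrow> nat) \<Rightarrow> 'k. f = fs 1 \<and>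
    (\<forall>a \<in> A. \<forall>i \<in> {1..r}. \<exists>k :: nat \<Rightarrow> 'k. seq_comp h S (fs i) [a] = lin_comb r k fs)"
proof -
  let ?r = "card I"
  have r: "?r \<ge> 1"
    using I card_gt_0_iff[of I] by (auto simp: Suc_le_eq)
  have "card {2..?r} = card (I - {z})"
    using I by simp
  then obtain b' where b': "bij_betw b' {2..?r} (I - {z})"
    using finite_same_card_bij[of "{2..?r}" "I - {z}"] I(1) by auto
  define b where "b = b'(1 := z)"
  have "bij_betw b {2..?r} (I - {z})"
    using b' by (rule bij_betw_cong[THEN iffD1, rotated]) (simp add: b_def)
  moreover have "bij_betw b {1} {z}"
    by (simp add: b_def bij_betw_def)
  ultimately have "bij_betw b ({1} \<union> {2..?r}) ({z} \<union> (I - {z}))"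
    by (intro bij_betw_combine) auto
  moreover have "{1} \<union> {2..?r} = {1..?r}" "{z} \<union> (I - {z}) = I"
    using r I(2) by auto
  ultimately have b: "bij_betw b {1..?r} I"
    by simp
  have "\<exists>k. seq_comp h S (F (b i)) [a] = lin_comb ?r k (\<lambda>i. F (b i))"
    if a: "a \<in> A" and i: "i \<in> {1..?r}" for a i
  proof -
    have "b i \<in> I"
      using bij_betwE[OF b] i by blast
    then obtain k where k: "\<And>n. seq_comp h S (F (b i)) [a] n = (\<Sum>y\<in>I. F y n * k y)"
      using stable[OF a] by blast
    have "seq_comp h S (F (b i)) [a] n = lin_comb ?r (\<lambda>j. k (b j)) (\<lambda>i. F (b i)) n" for n
      unfolding lin_comb_def k using sum.reindex_bij_betw[OF b, of "\<lambda>y. F y n * k y"] by simp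
    then show ?thesis
      by blast
  qed
  moreover have "f = F (b 1)"
    by (simp add: f b_def)
  ultimately show ?thesis
    using r by (intro exI[of _ ?r] conjI exI[of _ "\<lambda>i. F (b i)"]) blast+
qed

text \<open>Splitting each entry of the row vector by quotients lets the coefficients depend on the
  quotient by \<open>?rep n\<close>, and so on whether \<open>?rep n @ [a]\<close> lies in the
  language.\<close>

lemma stable_family_if_regular_seq:
  fixes S :: "'d::finite \<Rightarrow> 'a num_sys"
    and f :: "('d \<Rightarrow> nat) \<Rightarrow> 'k::{semiring_0,monoid_mult}"
  assumes reg: "regular_seq h S f" and bij: "bij_betw (prod_rep h S) UNIV (prod_lang h S)"
    and LA: "prod_lang h S \<subseteq> lists (prod_alph h S)"
    and fin: "finite (range (lquot (prod_lang h S)))"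
  shows "\<exists>r \<ge> 1. \<exists>fs :: nat \<Rightarrow> ('d \<Rightarrow> nat) \<Rightarrow> 'k. f = fs 1 \<and>
    (\<forall>a \<in> prod_alph h S. \<forall>i \<in> {1..r}. \<exists>k :: nat \<Rightarrow> 'k.
      seq_comp h S (fs i) [a] = lin_comb r k fs)"
proof (rule recognizableE[OF reg[unfolded regular_seq_def]])
  let ?A = "prod_alph h S" and ?L = "prod_lang h S" and ?rep = "prod_rep h S"
  let ?X = "range (lquot ?L)"
  fix r :: nat and v :: "('d \<Rightarrow> 'a) list \<Rightarrow> nat \<Rightarrow> 'k"
    and m :: "('d \<Rightarrow> 'a) \<Rightarrow> nat \<Rightarrow> nat \<Rightarrow> 'k" and g :: "nat \<Rightarrow> 'k"
  assume v: "\<And>u a j. u \<in> lists ?A \<Longrightarrow> a \<in> ?A \<Longrightarrow> j < r \<Longrightarrow> v (u @ [a]) j = (\<Sum>i<r. v u i * m a i j)"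
    and s: "\<And>w. w \<in> lists ?A \<Longrightarrow>
      (if w \<in> ?L then f (prod_val h S w) else 0) = (\<Sum>j<r. v w j * g j)"
  have repA: "?rep n \<in> lists ?A" for n
    using bij LA by (auto simp: bij_betw_def)
  have rep_val: "?rep (prod_val h S w) = w" if "w \<in> ?L" for w
    using bij that by (metis bij_betw_def f_inv_into_f prod_val_def)
  define F :: "(nat \<times> ('d \<Rightarrow> 'a) list set) option \<Rightarrow> ('d \<Rightarrow> nat) \<Rightarrow> 'k" where
    "F = (\<lambda>x n. case x of None \<Rightarrow> f n
      | Some (j, q) \<Rightarrow> if lquot ?L (?rep n) = q then v (?rep n) j else 0)"
  define I where "I = insert None (Some ` ({..<r} \<times> ?X))"
  \<comment> \<open>For fixed \<open>n\<close> only the quotient by \<open>?rep n\<close>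
    contributes, so constants \<open>c j q\<close> act like coefficients that depend on this
    quotient. The additional sequence \<open>f\<close> gets coefficient 0.\<close>
  have sum_F: "(\<Sum>y\<in>I. F y n * (case y of None \<Rightarrow> 0 | Some (j, q) \<Rightarrow> c j q))
      = (\<Sum>j<r. v (?rep n) j * c j (lquot ?L (?rep n)))" (is "?lhs = _") for n c
  proof -
    have "?lhs = (\<Sum>(j, q)\<in>{..<r} \<times> ?X. F (Some (j, q)) n * c j q)"
      unfolding I_def using fin
      by (subst sum.insert) (auto simp: sum.reindex case_prod_unfold)
    also have "\<dots> = (\<Sum>j<r. \<Sum>q\<in>?X. F (Some (j, q)) n * c j q)"
      by (simp add: sum.cartesian_product)
    also have "\<dots> = (\<Sum>j<r. \<Sum>q\<in>?X. if lquot ?L (?rep n) = q then v (?rep n) j * c j q else 0)"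
      by (intro sum.cong) (auto simp: F_def)
    also have "\<dots> = (\<Sum>j<r. v (?rep n) j * c j (lquot ?L (?rep n)))"
      using fin by (simp add: sum.delta)
    finally show ?thesis .
  qed
  have mem: "?rep n @ [a] \<in> ?L \<longleftrightarrow> [a] \<in> lquot ?L (?rep n)" for n a
    by (simp add: lquot_def)
  show ?thesis
  proof (rule stable_family_reindex[where F = F and I = I and z = None])
    show "finite I" "None \<in> I" "f = F None"
      using fin by (auto simp: I_def F_def)
  next
    fix a x assume a: "a \<in> ?A" and x: "x \<in> I"
    show "\<exists>k. \<forall>n. seq_comp h S (F x) [a] n = (\<Sum>y\<in>I. F y n * k y)"
    proof (cases x)
      case None
      \<comment> \<open>Appending \<open>a\<close> turns the column \<open>g\<close> into the
        product of \<open>m a\<close> and \<open>g\<close>; it is kept only for quotients that admit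
        \<open>a\<close>.\<close>
      define c where "c = (\<lambda>i q. if [a] \<in> q then \<Sum>j<r. m a i j * g j else 0)"
      have "seq_comp h S (F x) [a] n = (\<Sum>i<r. v (?rep n) i * c i (lquot ?L (?rep n)))" for n
      proof (cases "?rep n @ [a] \<in> ?L")
        case True
        then have "seq_comp h S (F x) [a] n = (\<Sum>j<r. v (?rep n @ [a]) j * g j)"
          using s[of "?rep n @ [a]"] repA a None by (auto simp: seq_comp_def F_def)
        also have "\<dots> = (\<Sum>j<r. \<Sum>i<r. v (?rep n) i * (m a i j * g j))"
          using v[OF repA a] by (simp add: sum_distrib_right mult.assoc)
        also have "\<dots> = (\<Sum>i<r. v (?rep n) i * (\<Sum>j<r. m a i j * g j))"
          by (subst sum.swap) (simp add: sum_distrib_left)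
        finally show ?thesis
          using True by (simp add: c_def mem)
      next
        case False
        then show ?thesis
          by (simp add: seq_comp_def c_def mem)
      qed
      then show ?thesis
        unfolding sum_F[symmetric] by blast
    next
      case (Some y)
      then obtain j p where y: "x = Some (j, p)" "j < r"
        using x by (auto simp: I_def)
      \<comment> \<open>Appending \<open>a\<close> leads from the quotient \<open>q\<close> to
        \<open>{w. a # w \<in> q}\<close>, by \<open>lquot_snoc\<close>. So column \<open>j\<close>
        of \<open>m a\<close> is used exactly for those \<open>q\<close> that admit \<open>a\<close>
        and lead to \<open>p\<close>.\<close>
      define c where "c = (\<lambda>i q. if [a] \<in> q \<and> {w. a # w \<in> q} = p then m a i j else 0)"
      have "seq_comp h S (F x) [a] n = (\<Sum>i<r. v (?rep n) i * c i (lquot ?L (?rep n)))" for n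
        using v[OF repA a y(2)]
        by (auto simp: seq_comp_def F_def y(1) c_def rep_val lquot_snoc mem)
      then show ?thesis
        unfolding sum_F[symmetric] by blast
    qed
  qed
qed

text \<open>Stability speaks only of words in the language. For the others prefix closure gives the
  update of the row vector: all extensions stay outside, and the zero row is mapped to the zero
  row.\<close>

lemma regular_seq_if_stable_family:
  fixes S :: "'d::finite \<Rightarrow> 'a num_sys"
    and fs :: "nat \<Rightarrow> ('d \<Rightarrow> nat) \<Rightarrow> 'k::{semiring_0,monoid_mult}"
  assumes bij: "bij_betw (prod_rep h S) UNIV (prod_lang h S)"
    and prefix: "prefix_closed (prod_lang h S)" and Nil: "[] \<in> prod_lang h S"
    and r: "r \<ge> 1"
    and stable: "\<forall>a \<in> prod_alph h S. \<forall>i \<in> {1..r}. \<exists>k :: nat \<Rightarrow> 'k.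
      seq_comp h S (fs i) [a] = lin_comb r k fs"
  shows "regular_seq h S (fs 1)"
proof -
  let ?L = "prod_lang h S" and ?val = "prod_val h S"
  have rep_val: "prod_rep h S (?val w) = w" if "w \<in> ?L" for w
    using bij that by (metis bij_betw_def f_inv_into_f prod_val_def)
  obtain k where k: "\<And>a i. a \<in> prod_alph h S \<Longrightarrow> i \<in> {1..r} \<Longrightarrow>
      seq_comp h S (fs i) [a] = lin_comb r (k a i) fs"
    using stable by metis
  \<comment> \<open>Coefficients act on the right of a row, so those for the sequence
    \<open>fs (Suc i)\<close> form column \<open>i\<close>. Matrix indices start at 0 and sequences
    at 1, hence \<open>Suc\<close>.\<close>
  define M where "M = (\<lambda>a. mat r r (\<lambda>(j, i). k a (Suc i) (Suc j)))"
  define v where "v = (\<lambda>w j. if w \<in> ?L then fs (Suc j) (?val w) else 0)"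
  define rowv where "rowv = (\<lambda>w. mat 1 r (\<lambda>(_, j). v w j))"
  define g :: "'k mat" where "g = mat r 1 (\<lambda>(i, _). if i = 0 then 1 else 0)"
  have carrier: "M a \<in> carrier_mat r r" "rowv w \<in> carrier_mat 1 r" "g \<in> carrier_mat r 1" for a w
    unfolding M_def rowv_def g_def by (rule mat_carrier)+
  have v_snoc: "v (u @ [a]) i = (\<Sum>j<r. v u j * k a (Suc i) (Suc j))"
    if a: "a \<in> prod_alph h S" and i: "i < r" for u a i
  proof (cases "u \<in> ?L")
    case True
    \<comment> \<open>The default 0 of \<open>seq_comp\<close> agrees with that of \<open>v\<close>,
      so this holds also if \<open>u @ [a]\<close> leaves the language.\<close>
    have "v (u @ [a]) i = seq_comp h S (fs (Suc i)) [a] (?val u)"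
      by (simp add: v_def seq_comp_def rep_val[OF True])
    also have "\<dots> = (\<Sum>j=1..r. fs j (?val u) * k a (Suc i) j)"
      using k[OF a, of "Suc i"] i by (simp add: lin_comb_def)
    also have "\<dots> = (\<Sum>j<r. fs (Suc j) (?val u) * k a (Suc i) (Suc j))"
      by (simp add: sum.atLeast1_atMost_eq)
    finally show ?thesis
      using True by (simp add: v_def)
  next
    case False
    then have "u @ [a] \<notin> ?L"
      using prefix unfolding prefix_closed_def by blast
    then show ?thesis
      using False by (simp add: v_def)
  qed
  have "recognizable (prod_alph h S) (\<lambda>w. if w \<in> ?L then fs 1 (?val w) else 0)"
  proof (rule recognizableI[OF r carrier(1) carrier(2) carrier(3)])
    show "rowv [] = rowv []" ..
    show "rowv (u @ [a]) = rowv u * M a" if "a \<in> prod_alph h S" for u a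
    proof (rule eq_matI)
      fix i j assume "i < dim_row (rowv u * M a)" "j < dim_col (rowv u * M a)"
      then have ij: "i = 0" "j < r"
        using carrier by (auto simp: rowv_def M_def)
      then show "rowv (u @ [a]) $$ (i, j) = (rowv u * M a) $$ (i, j)"
        using mult_mat_entry[OF carrier(2) carrier(1), of 0 j u a] v_snoc[OF that, of j u]
        by (simp add: rowv_def M_def)
    qed (simp_all add: rowv_def M_def)
    show "(if w \<in> ?L then fs 1 (?val w) else 0) = (rowv w * g) $$ (0, 0)" for w
    proof -
      have "(rowv w * g) $$ (0, 0) = (\<Sum>j<r. v w j * (if j = 0 then 1 else 0))"
        using mult_mat_entry[OF carrier(2) carrier(3), of 0 0 w] by (simp add: rowv_def g_def)
      also have "\<dots> = v w 0"
        using r by (simp add: if_distrib[of "\<lambda>x. _ * x"] sum.delta' cong: if_cong)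
      finally show ?thesis
        by (simp add: v_def)
    qed
  qed
  then show ?thesis
    unfolding regular_seq_def .
qed

theorem theorem5p10:
  fixes S :: "'d::finite \<Rightarrow> 'a num_sys"
    and h :: 'a
    and f :: "('d \<Rightarrow> nat) \<Rightarrow> 'k::{semiring_0,monoid_mult}"
  assumes "\<And>i. abstract_num_sys (S i)"
    and "\<And>i. h \<notin> alph (S i)"
    and "\<And>i. prefix_closed (lang (S i))"
  shows "regular_seq h S f \<longleftrightarrow>
    (\<exists>r \<ge> 1. \<exists>fs :: nat \<Rightarrow> ('d \<Rightarrow> nat) \<Rightarrow> 'k.
      f = fs 1 \<and>
      (\<forall>a \<in> prod_alph h S. \<forall>i \<in> {1..r}. \<exists>k :: nat \<Rightarrow> 'k.
        seq_comp h S (fs i) [a] = lin_comb r k fs))"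
proof -
  have reg: "regular_lang (alph (S i)) (lang (S i))" and inf: "infinite (lang (S i))" for i
    using assms(1)[of i] by (auto simp: abstract_num_sys_def)
  note L = regular_lang_subset_lists[OF reg]
  \<comment> \<open>An infinite language contains some word, and the empty word is a prefix of
    it.\<close>
  have Nil: "[] \<in> lang (S i)" for i
    using infinite_imp_nonempty[OF inf] assms(3) unfolding prefix_closed_def
    by (metis append_Nil ex_in_conv)
  have LA: "prod_lang h S \<subseteq> lists (prod_alph h S)" and Nil': "[] \<in> prod_lang h S"
    by (auto simp: prod_lang_eq[OF L assms(2)] Nil_in_padded_iff Nil)
  note bij = bij_betw_prod_rep[OF assms(1,2)]
  show ?thesis
  proof
    assume "regular_seq h S f"
    then show "\<exists>r \<ge> 1. \<exists>fs :: nat \<Rightarrow> ('d \<Rightarrow> nat) \<Rightarrow> 'k. f = fs 1 \<and>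
        (\<forall>a \<in> prod_alph h S. \<forall>i \<in> {1..r}. \<exists>k :: nat \<Rightarrow> 'k.
          seq_comp h S (fs i) [a] = lin_comb r k fs)"
      using stable_family_if_regular_seq[OF _ bij LA finite_lquot_prod_lang[OF reg assms(2)]]
      by blast
  next
    assume "\<exists>r \<ge> 1. \<exists>fs :: nat \<Rightarrow> ('d \<Rightarrow> nat) \<Rightarrow> 'k. f = fs 1 \<and>
        (\<forall>a \<in> prod_alph h S. \<forall>i \<in> {1..r}. \<exists>k :: nat \<Rightarrow> 'k.
          seq_comp h S (fs i) [a] = lin_comb r k fs)"
    then show "regular_seq h S f"
      using regular_seq_if_stable_family[OF bij prefix_closed_prod_lang[OF L assms(2,3) Nil] Nil']
      by blast
  qed
qed

end
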